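(* Let $R$ be an aperiodic two-step rule. For each step direction $\theta\in\{e,n,w,s\}$ the full-plane generating function $F_\theta$ satisfies a functional equation of the form $$F_\theta(x,y)=A_\theta(x,y)+B_\theta(x,y)F_\theta(x,y),$$ where - $A_\theta(x,y)$ is the generating function of walks obeying $R$ which start in any direction and contain only one $\theta$ step, being their last step; and - $B_\theta(x,y)$ is the generating function of walks obeying $R$ which start with a step in any direction from $f(\theta)$ and contain only one $\theta$ step, being their last step.
   Context: Steps on $\mathbb Z^2$: east $(1,0)$, north $(0,1)$, west $(-1,0)$, south $(0,-1)$, abbreviated $e,n,w,s$. A two-step rule is a map $R:\{e,n,w,s\}^2\to\{0,1\}$; $R(i,j)=1$ means a step of type $i$ may be immediately followed by one of type $j$. Its transfer matrix is $T=(R(i,j))_{i,j}$. The rule is aperiodic if there is $k\ge1$ with $(T^k)_{ij}>0$ for all $i,j$. A walk obeying $R$ is a nonempty finite sequence of steps, starting at the origin, with arbitrary first step and with $R(i,j)=1$ for each consecutive pair of steps $(i,j)$. $f(\theta)=\{j:R(\theta,j)=1\}$ is the set of step types which can follow $\theta$. The generating function of a class of walks is $\sum t^m x^a y^b$ over walks in the class, where $m$ is the length and $(a,b)$ the endpoint (the walk starting at the origin); it is a power series in $t$ with coefficients Laurent polynomials in $x,y$. $F_\theta(x,y)\equiv F_\theta(t;x,y)$ is the generating function of all walks in the full plane obeying $R$ whose last step is $\theta$; the variable $t$ is often suppressed. *)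

theory Defs
  imports
    "HOL-Analysis.Finite_Cartesian_Product"
    "HOL-Computational_Algebra.Formal_Power_Series"
    "HOL-Library.Poly_Mapping"
    "HOL-Library.Product_Plus"
begin

datatype step = East | North | West | South

instance step :: finite
proof
  have "(UNIV :: step set) = {East, North, West, South}"
    using step.exhaust by blast
  then show "finite (UNIV :: step set)"
    by (metis finite.emptyI finite_insert)
qed

fun step_vec :: "step \<Rightarrow> int \<times> int" where
  "step_vec East = (1, 0)"
| "step_vec North = (0, 1)"
| "step_vec West = (-1, 0)"
| "step_vec South = (0, -1)"

type_synonym two_step_rule = "step \<Rightarrow> step \<Rightarrow> bool"

definition transfer_matrix :: "two_step_rule \<Rightarrow> nat ^ step ^ step" where
  "transfer_matrix R = (\<chi> i j. of_bool (R i j))"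

text \<open>The power is written as an iterated matrix product \<open>(**)\<close>, because \<open>*\<close> and \<open>^\<close> on the
  type \<open>nat ^ step ^ step\<close> act componentwise.\<close>

definition mat_pow :: "nat ^ 'n ^ 'n \<Rightarrow> nat \<Rightarrow> nat ^ 'n ^ 'n" where
  "mat_pow M k = ((\<lambda>P. P ** M) ^^ k) (mat 1)"

definition aperiodic :: "two_step_rule \<Rightarrow> bool" where
  "aperiodic R \<longleftrightarrow> (\<exists>k\<ge>1. \<forall>i j. vec_nth (vec_nth (mat_pow (transfer_matrix R) k) i) j > 0)"

definition followers :: "two_step_rule \<Rightarrow> step \<Rightarrow> step set" where
  "followers R \<theta> = {j. R \<theta> j}"

text \<open>All walks start at the origin, so a walk is identified with its sequence of steps.\<close>

definition walks :: "two_step_rule \<Rightarrow> step list set" where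
  "walks R = {w. w \<noteq> [] \<and> successively R w}"

definition endpoint :: "step list \<Rightarrow> int \<times> int" where
  "endpoint w = (\<Sum>s\<leftarrow>w. step_vec s)"

text \<open>Finitely supported maps \<open>int \<times> int \<Rightarrow>\<^sub>0 int\<close> with the convolution product are the Laurent
  polynomials in \<open>x, y\<close>: the exponent pair \<open>(a, b)\<close> stands for the monomial \<open>x\<^sup>a y\<^sup>b\<close>.  The variable
  of the power series is \<open>t\<close>.\<close>

type_synonym laurent_poly2 = "int \<times> int \<Rightarrow>\<^sub>0 int"

definition gen_fun :: "step list set \<Rightarrow> laurent_poly2 fps" where
  "gen_fun C = Abs_fps (\<lambda>m. \<Sum>w\<in>{w\<in>C. length w = m}. Poly_Mapping.single (endpoint w) 1)"

text \<open>The sum in \<open>gen_fun_def\<close> is always a genuine finite sum.\<close>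

lemma finite_walks_of_length: "finite {w\<in>C. length w = m}" for C :: "step list set"
  by (rule finite_subset[OF _ finite_lists_length_eq[of "UNIV :: step set" m]]) auto

definition F :: "two_step_rule \<Rightarrow> step \<Rightarrow> laurent_poly2 fps" where
  "F R \<theta> = gen_fun {w \<in> walks R. last w = \<theta>}"

definition A :: "two_step_rule \<Rightarrow> step \<Rightarrow> laurent_poly2 fps" where
  "A R \<theta> = gen_fun {w \<in> walks R. count_list w \<theta> = 1 \<and> last w = \<theta>}"

definition B :: "two_step_rule \<Rightarrow> step \<Rightarrow> laurent_poly2 fps" where
  "B R \<theta> = gen_fun {w \<in> walks R. hd w \<in> followers R \<theta> \<and> count_list w \<theta> = 1 \<and> last w = \<theta>}"

end

theory Submission
  imports Defs
begin

text \<open>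
  The equation is the last-passage decomposition of a walk at the step \<open>\<theta>\<close>.  Let \<open>w\<close> be a walk
  with last step \<open>\<theta>\<close>.  If \<open>\<theta>\<close> occurs only once, \<open>w\<close> is counted by \<open>A\<close>.  Otherwise cut \<open>w\<close>
  immediately after its penultimate \<open>\<theta>\<close>, so that \<open>w = u @ v\<close>.  Then \<open>u\<close> is again an arbitrary walk
  ending in \<open>\<theta>\<close>, and \<open>v\<close> is a walk whose only \<open>\<theta>\<close> is its last step.  A two-step rule remembers
  nothing but the preceding step, so the only condition tying \<open>v\<close> to \<open>u\<close> is that the first step of
  \<open>v\<close> may follow \<open>\<theta>\<close>; this is why the factor counted by \<open>B\<close> does not depend on \<open>u\<close>
  (lemma \<open>walks_ending_decomp\<close>).

  The cut can be recovered from \<open>w\<close> (lemma \<open>inj_on_append_last_passage\<close>), and length and endpoint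
  are additive under concatenation.  Hence the class of all such \<open>w\<close> has the product of the two
  generating functions (lemma \<open>gen_fun_append\<close>).
\<close>

section \<open>Generating functions of disjoint unions and of concatenations\<close>

lemma endpoint_append: "endpoint (u @ v) = endpoint u + endpoint v"
  by (simp add: endpoint_def)

lemma gen_fun_nth:
  "fps_nth (gen_fun C) m = (\<Sum>w\<in>{w\<in>C. length w = m}. Poly_Mapping.single (endpoint w) 1)"
  by (simp add: gen_fun_def)

lemma gen_fun_Un_disjoint:
  assumes "C \<inter> D = {}"
  shows "gen_fun (C \<union> D) = gen_fun C + gen_fun D"
proof (rule fps_ext)
  fix m
  have "{w \<in> C \<union> D. length w = m} = {w \<in> C. length w = m} \<union> {w \<in> D. length w = m}"
    by blast
  moreover have "{w \<in> C. length w = m} \<inter> {w \<in> D. length w = m} = {}"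
    using assms by blast
  ultimately show "fps_nth (gen_fun (C \<union> D)) m = fps_nth (gen_fun C + gen_fun D) m"
    by (simp add: gen_fun_nth sum.union_disjoint finite_walks_of_length)
qed

text \<open>Every pair \<open>(u, v)\<close> contributes the monomial of \<open>u @ v\<close> to the Cauchy product, and unique
  factorisation guarantees that no concatenation is counted twice.\<close>

lemma gen_fun_append:
  assumes inj: "inj_on (\<lambda>(u, v). u @ v) (U \<times> V)"
  shows "gen_fun ((\<lambda>(u, v). u @ v) ` (U \<times> V)) = gen_fun U * gen_fun V"
proof (rule fps_ext)
  fix m
  let ?app = "\<lambda>(u, v). u @ v :: step list"
  let ?mon = "\<lambda>w. Poly_Mapping.single (endpoint w) 1 :: laurent_poly2"
  let ?U = "\<lambda>i. {u \<in> U. length u = i}" and ?V = "\<lambda>i. {v \<in> V. length v = i}"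
  let ?P = "{p \<in> U \<times> V. length (fst p) + length (snd p) = m}"
  let ?S = "SIGMA i:{0..m}. ?U i \<times> ?V (m - i)"
  have img: "{w \<in> ?app ` (U \<times> V). length w = m} = ?app ` ?P"
    by force
  have inj_P: "inj_on ?app ?P"
    by (rule inj_on_subset[OF inj]) blast
  have proj: "bij_betw snd ?S ?P"
    by (rule bij_betw_byWitness[where f' = "\<lambda>p. (length (fst p), p)"]) auto
  have "fps_nth (gen_fun (?app ` (U \<times> V))) m = (\<Sum>p\<in>?P. ?mon (?app p))"
    by (simp add: gen_fun_nth img sum.reindex[OF inj_P])
  also have "\<dots> = (\<Sum>q\<in>?S. ?mon (?app (snd q)))"
    by (rule sum.reindex_bij_betw[OF proj, symmetric])
  also have "\<dots> = (\<Sum>i\<in>{0..m}. \<Sum>p\<in>?U i \<times> ?V (m - i). ?mon (?app p))"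
    by (subst sum.Sigma) (auto simp: finite_walks_of_length split_def)
  also have "\<dots> = (\<Sum>i\<in>{0..m}. (\<Sum>u\<in>?U i. ?mon u) * (\<Sum>v\<in>?V (m - i). ?mon v))"
    by (simp add: sum_product sum.cartesian_product split_def endpoint_append mult_single)
  also have "\<dots> = fps_nth (gen_fun U * gen_fun V) m"
    by (simp add: fps_mult_nth gen_fun_nth)
  finally show "fps_nth (gen_fun (?app ` (U \<times> V))) m = fps_nth (gen_fun U * gen_fun V) m" .
qed

section \<open>Cutting a word after the penultimate occurrence of a letter\<close>

text \<open>If two such factorisations were cut at different places, the longer second factor would
  contain the final \<open>x\<close> of the longer first factor in addition to the \<open>x\<close> that the shorter
  second factor already has.\<close>

lemma append_last_passage_cancel:
  assumes eq: "u @ v = u' @ v'"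
    and u: "u \<noteq> []" "last u = x" and u': "u' \<noteq> []" "last u' = x"
    and v: "count_list v x = 1" and v': "count_list v' x = 1"
  shows "u = u' \<and> v = v'"
proof -
  have no_overlap: "us = []"
    if "last (p @ us) = x" "count_list q x = 1" "count_list (us @ q) x = 1" for p us q
  proof (rule ccontr)
    assume "us \<noteq> []"
    with that(1) have "x \<in> set us"
      by (metis last_appendR last_in_set)
    with that(2,3) show False
      by (simp add: count_list_0_iff)
  qed
  from eq obtain us where "u = u' @ us \<and> us @ v = v' \<or> u @ us = u' \<and> v = us @ v'"
    by (auto simp: append_eq_append_conv2)
  then show ?thesis
    using no_overlap u u' v v' by (metis append_Nil append_Nil2)
qed

lemma inj_on_append_last_passage:
  assumes "\<And>u. u \<in> U \<Longrightarrow> u \<noteq> [] \<and> last u = x" and "\<And>v. v \<in> V \<Longrightarrow> count_list v x = 1"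
  shows "inj_on (\<lambda>(u, v). u @ v) (U \<times> V)"
proof (rule inj_onI, clarify)
  fix u v u' v'
  assume "u \<in> U" "v \<in> V" "u' \<in> U" "v' \<in> V" "u @ v = u' @ v'"
  then show "u = u' \<and> v = v'"
    using assms append_last_passage_cancel by metis
qed

lemma split_last_passage:
  assumes "w \<noteq> []" "last w = x" "count_list w x \<noteq> 1"
  obtains u v where "w = u @ v" "u \<noteq> []" "last u = x" "v \<noteq> []" "last v = x" "count_list v x = 1"
proof -
  have w: "w = butlast w @ [x]"
    using assms by (metis append_butlast_last_id)
  then have "count_list w x = count_list (butlast w) x + 1"
    by (metis count_list_append count_list.simps add_0)
  with assms(3) have "x \<in> set (butlast w)"
    by (metis count_notin add_0)
  then obtain ys zs where "butlast w = ys @ x # zs" "x \<notin> set zs"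
    by (metis split_list_last)
  with w have "w = (ys @ [x]) @ (zs @ [x])" "count_list (zs @ [x]) x = 1"
    by (simp_all add: count_notin)
  then show thesis
    by (intro that[of "ys @ [x]" "zs @ [x]"]) auto
qed

section \<open>Walks ending in a given step\<close>

lemma append_mem_walks_iff:
  assumes "u \<noteq> []" "v \<noteq> []"
  shows "u @ v \<in> walks R \<longleftrightarrow> u \<in> walks R \<and> v \<in> walks R \<and> hd v \<in> followers R (last u)"
  using assms by (auto simp: walks_def followers_def successively_append_iff)

text \<open>The union is disjoint because a concatenation \<open>u @ v\<close> inherits an occurrence of \<open>\<theta>\<close> from
  each of its factors.\<close>

lemma walks_ending_decomp:
  fixes R :: two_step_rule and \<theta> :: step
  defines "W \<equiv> {w \<in> walks R. last w = \<theta>}"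
    and "S \<equiv> {w \<in> walks R. count_list w \<theta> = 1 \<and> last w = \<theta>}"
    and "V \<equiv> {w \<in> walks R. hd w \<in> followers R \<theta> \<and> count_list w \<theta> = 1 \<and> last w = \<theta>}"
  shows "W = S \<union> (\<lambda>(u, v). u @ v) ` (W \<times> V)"
    and "S \<inter> (\<lambda>(u, v). u @ v) ` (W \<times> V) = {}"
proof -
  have nonempty: "w \<noteq> []" if "w \<in> walks R" for w
    using that by (simp add: walks_def)
  have glue: "u @ v \<in> W \<and> u @ v \<notin> S" if "u \<in> W" "v \<in> V" for u v
  proof -
    have u: "u \<in> walks R" "u \<noteq> []" "last u = \<theta>"
      using that nonempty by (auto simp: W_def)
    have v: "v \<in> walks R" "v \<noteq> []" "hd v \<in> followers R \<theta>" "count_list v \<theta> = 1" "last v = \<theta>"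
      using that nonempty by (auto simp: V_def)
    have "u @ v \<in> W"
      using u v by (simp add: W_def append_mem_walks_iff)
    moreover have "count_list u \<theta> \<noteq> 0"
      using u by (metis count_list_0_iff last_in_set)
    ultimately show ?thesis
      using v by (simp add: S_def)
  qed
  have cut: "w \<in> (\<lambda>(u, v). u @ v) ` (W \<times> V)" if "w \<in> W" "w \<notin> S" for w
  proof -
    have w: "w \<in> walks R" "last w = \<theta>" "count_list w \<theta> \<noteq> 1"
      using that by (auto simp: W_def S_def)
    obtain u v where uv: "w = u @ v" "u \<noteq> []" "last u = \<theta>" "v \<noteq> []" "last v = \<theta>"
        "count_list v \<theta> = 1"
      using split_last_passage[OF nonempty[OF w(1)] w(2,3)] .
    then have "u \<in> W" "v \<in> V"
      using w(1) by (auto simp: W_def V_def append_mem_walks_iff)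
    with uv(1) show ?thesis
      by force
  qed
  have "S \<subseteq> W"
    by (auto simp: S_def W_def)
  with glue cut show "W = S \<union> (\<lambda>(u, v). u @ v) ` (W \<times> V)"
    by auto
  from glue show "S \<inter> (\<lambda>(u, v). u @ v) ` (W \<times> V) = {}"
    by auto
qed

theorem theorem1:
  fixes R :: two_step_rule and \<theta> :: step
  assumes "aperiodic R"
  shows "F R \<theta> = A R \<theta> + B R \<theta> * F R \<theta>"
proof -
  define W where "W = {w \<in> walks R. last w = \<theta>}"
  define S where "S = {w \<in> walks R. count_list w \<theta> = 1 \<and> last w = \<theta>}"
  define V where "V = {w \<in> walks R. hd w \<in> followers R \<theta> \<and> count_list w \<theta> = 1 \<and> last w = \<theta>}"
  have "inj_on (\<lambda>(u, v). u @ v) (W \<times> V)"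
    by (rule inj_on_append_last_passage[where x = \<theta>]) (auto simp: W_def V_def walks_def)
  then have product: "gen_fun ((\<lambda>(u, v). u @ v) ` (W \<times> V)) = gen_fun W * gen_fun V"
    by (rule gen_fun_append)
  have "gen_fun W = gen_fun (S \<union> (\<lambda>(u, v). u @ v) ` (W \<times> V))"
    using walks_ending_decomp(1)[of R \<theta>] by (simp add: W_def S_def V_def)
  also have "\<dots> = gen_fun S + gen_fun W * gen_fun V"
    using walks_ending_decomp(2)[of R \<theta>] product
    by (simp add: W_def S_def V_def gen_fun_Un_disjoint)
  finally show ?thesis
    by (simp add: F_def A_def B_def W_def S_def V_def mult.commute)
qed

end
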